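(* Any metric space admitting locally strong Lipschitz contractions is (weakly) locally Lipschitz contractible; that is, it is weakly locally Lipschitz contractible, and it is locally Lipschitz contractible.
   Context: $U(x,r)$ is the open metric ball. For subsets $U\subset V$ of a metric space, a *Lipschitz contraction* of $U$ to $x_0\in V$ in $V$ is a Lipschitz map $h:U\times[0,1]\to V$ (i.e. $d(h(x,t),h(x',t'))\le C(d(x,x')+|t-t'|)$ for some constant $C$) with $h(\cdot,0)$ the inclusion and $h(\cdot,1)\equiv x_0$; then $U$ is said to be Lipschitz contractible to $x_0$ in $V$. A metric space $X$ is *locally Lipschitz contractible (LLC)* if for any $x\in X$ and $r>0$ there is $r'\in(0,r]$ such that $U(x,r')$ is Lipschitz contractible to $x$ in $U(x,r)$. It is *weakly locally Lipschitz contractible (WLLC)* if for any $x\in X$ and any open $U\ni x$ there is an open $V$ with $x\in V\subset U$ such that $V$ is Lipschitz contractible in $U$ to some point of $U$. A metric space $X$ *admits locally strong Lipschitz contractions* if for any $x\in X$ there exist $r>0$ and $\gamma>0$ such that every subset $S\subset U(x,r)$ admits a Lipschitz contraction $\varphi:S\times[0,1]\to X$ (in $X$) to some point of $X$ satisfying $$d(\varphi(z,t),\varphi(z',t'))\le\gamma\,\mathrm{diam}(S)\,|t-t'|+\gamma\,d(z,z')$$ for all $z,z'\in S$ and $t,t'\in[0,1]$. *)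

theory Defs
  imports "HOL-Analysis.Analysis"
begin

context Metric_space
begin

text \<open>Carrier-based counterpart of \<^const>\<open>diameter\<close>. As there, the value is meaningful only for
  bounded \<open>S\<close>, since a real supremum of an unbounded set is unspecified; below it is only applied
  to subsets of balls.\<close>

definition mdiameter :: "'a set \<Rightarrow> real" where
  "mdiameter S = (if S = {} then 0 else SUP (x, y) \<in> S \<times> S. d x y)"

definition lipschitz_contraction :: "'a set \<Rightarrow> 'a set \<Rightarrow> 'a \<Rightarrow> ('a \<times> real \<Rightarrow> 'a) \<Rightarrow> bool" where
  "lipschitz_contraction U V x0 h \<longleftrightarrow>
     U \<subseteq> V \<and> V \<subseteq> M \<and> x0 \<in> V \<and>
     h \<in> U \<times> {0..1} \<rightarrow> V \<and>
     (\<exists>C. \<forall>x\<in>U. \<forall>x'\<in>U. \<forall>t\<in>{0..1}. \<forall>t'\<in>{0..1}.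
        d (h (x, t)) (h (x', t')) \<le> C * (d x x' + \<bar>t - t'\<bar>)) \<and>
     (\<forall>x\<in>U. h (x, 0) = x) \<and>
     (\<forall>x\<in>U. h (x, 1) = x0)"

definition lipschitz_contractible_to :: "'a set \<Rightarrow> 'a set \<Rightarrow> 'a \<Rightarrow> bool" where
  "lipschitz_contractible_to U V x0 \<longleftrightarrow> (\<exists>h. lipschitz_contraction U V x0 h)"

definition locally_lipschitz_contractible :: bool where
  "locally_lipschitz_contractible \<longleftrightarrow>
     (\<forall>x\<in>M. \<forall>r>0. \<exists>r'\<in>{0<..r}. lipschitz_contractible_to (mball x r') (mball x r) x)"

definition weakly_locally_lipschitz_contractible :: bool where
  "weakly_locally_lipschitz_contractible \<longleftrightarrow>
     (\<forall>x\<in>M. \<forall>U. openin mtopology U \<and> x \<in> U \<longrightarrow>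
        (\<exists>V. openin mtopology V \<and> x \<in> V \<and> V \<subseteq> U \<and>
             (\<exists>y\<in>U. lipschitz_contractible_to V U y)))"

definition admits_locally_strong_lipschitz_contractions :: bool where
  "admits_locally_strong_lipschitz_contractions \<longleftrightarrow>
     (\<forall>x\<in>M. \<exists>r>0. \<exists>\<gamma>>0. \<forall>S. S \<subseteq> mball x r \<longrightarrow>
        (\<exists>y\<in>M. \<exists>\<phi>. lipschitz_contraction S M y \<phi> \<and>
           (\<forall>z\<in>S. \<forall>z'\<in>S. \<forall>t\<in>{0..1}. \<forall>t'\<in>{0..1}.
              d (\<phi> (z, t)) (\<phi> (z', t')) \<le> \<gamma> * mdiameter S * \<bar>t - t'\<bar> + \<gamma> * d z z')))"

end

end

theory Submission
  imports Defs
begin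

text \<open>On a small ball \<open>U(x,r')\<close> the strong estimate makes every track of the contraction
  \<open>\<phi>\<close> short, of length at most \<open>2 \<gamma> r'\<close>, so \<open>\<phi>\<close> stays inside a
  prescribed ball. It ends at some point \<open>y\<close> rather than at \<open>x\<close>; this is repaired by
  following \<open>\<phi>\<close> by the reversed track of \<open>x\<close>, which leads from \<open>y\<close> back to
  \<open>x\<close>.\<close>

context Metric_space
begin

text \<open>The triangle inequality through the centre bounds every distance in the ball. The
  assumption \<open>0 \<le> r\<close> covers the empty ball, whose \<open>mdiameter\<close> is 0 by
  convention.\<close>

lemma mdiameter_mball_le:
  assumes "0 \<le> r"
  shows "mdiameter (mball x r) \<le> 2 * r"
proof (cases "mball x r = {}")
  case False
  have "d y z \<le> 2 * r" if "y \<in> mball x r" "z \<in> mball x r" for y z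
    using that triangle'[of y x z] commute by auto
  then have "(SUP (y, z) \<in> mball x r \<times> mball x r. d y z) \<le> 2 * r"
    using False by (intro cSUP_least) auto
  with False show ?thesis by (simp add: mdiameter_def)
qed (use assms in \<open>simp add: mdiameter_def\<close>)

lemma lipschitz_contractible_to_mono:
  assumes "lipschitz_contractible_to U V y" "V \<subseteq> W" "W \<subseteq> M"
  shows "lipschitz_contractible_to U W y"
proof -
  obtain h where "lipschitz_contraction U V y h"
    using assms(1) unfolding lipschitz_contractible_to_def by blast
  then have "lipschitz_contraction U W y h"
    unfolding lipschitz_contraction_def using assms(2,3)
    by (intro conjI; (elim conjE)?; blast)
  then show ?thesis
    unfolding lipschitz_contractible_to_def by blast
qed

text \<open>The concatenated homotopy takes only values of \<open>h\<close>, so it stays in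
  \<open>V\<close>, and running each half at double speed costs only a factor 2 in the Lipschitz
  constant.\<close>

lemma lipschitz_contractible_to_member:
  assumes "lipschitz_contractible_to U V y" and x: "x \<in> U"
  shows "lipschitz_contractible_to U V x"
proof -
  obtain h C where UV: "U \<subseteq> V" "V \<subseteq> M" and h: "h \<in> U \<times> {0..1} \<rightarrow> V"
    and C: "\<And>z z' t t'. \<lbrakk>z \<in> U; z' \<in> U; t \<in> {0..1}; t' \<in> {0..1}\<rbrakk> \<Longrightarrow>
        d (h (z, t)) (h (z', t')) \<le> C * (d z z' + \<bar>t - t'\<bar>)"
    and h0: "\<And>z. z \<in> U \<Longrightarrow> h (z, 0) = z" and h1: "\<And>z. z \<in> U \<Longrightarrow> h (z, 1) = y"
    using assms(1) unfolding lipschitz_contractible_to_def lipschitz_contraction_def by metis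
  define L where "L = \<bar>C\<bar>"
  have L0: "0 \<le> L" by (simp add: L_def)
  have L: "d (h (z, t)) (h (z', t')) \<le> L * (d z z' + \<bar>t - t'\<bar>)"
    if "z \<in> U" "z' \<in> U" "t \<in> {0..1}" "t' \<in> {0..1}" for z z' t t'
  proof -
    have "C * (d z z' + \<bar>t - t'\<bar>) \<le> L * (d z z' + \<bar>t - t'\<bar>)"
      by (intro mult_right_mono) (auto simp: L_def)
    with C[OF that] show ?thesis by linarith
  qed
  \<comment> \<open>The halves match at \<open>t = 1/2\<close>, since
    \<open>h (z, 1) = y = h (x, 1)\<close>. The second half does not depend on
    \<open>z\<close>.\<close>
  define k where "k = (\<lambda>(z, t). if t \<le> 1/2 then h (z, 2 * t) else h (x, 2 - 2 * t))"
  have hM: "h (z, t) \<in> M" if "z \<in> U" "t \<in> {0..1}" for z t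
    using that h UV by blast
  have kV: "k \<in> U \<times> {0..1} \<rightarrow> V"
    using x by (auto simp: k_def intro!: funcset_mem[OF h])
  \<comment> \<open>With the two times on opposite sides of \<open>1/2\<close>, the distance is
    split at \<open>y\<close>, where the halves meet. Each piece then stays on a single track of
    \<open>h\<close>, that of \<open>z\<close> or that of \<open>x\<close>.\<close>
  have mixed: "d (k (z, t)) (k (z', t')) \<le> 2 * L * (d z z' + \<bar>t - t'\<bar>)"
    if "z \<in> U" "z' \<in> U" "t \<in> {0..1}" "t' \<in> {0..1}" "t \<le> 1/2" "\<not> t' \<le> 1/2" for z z' t t'
  proof -
    have "d (k (z, t)) (k (z', t')) = d (h (z, 2 * t)) (h (x, 2 - 2 * t'))"
      using that by (simp add: k_def)
    also have "\<dots> \<le> d (h (z, 2 * t)) (h (z, 1)) + d (h (x, 1)) (h (x, 2 - 2 * t'))"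
      using that x triangle[of "h (z, 2 * t)" y "h (x, 2 - 2 * t')"] hM
        hM[of x 1] by (simp add: h1)
    also have "\<dots> \<le> L * (d z z + \<bar>2 * t - 1\<bar>) + L * (d x x + \<bar>1 - (2 - 2 * t')\<bar>)"
      using that x by (intro add_mono L) auto
    \<comment> \<open>No loss occurs here: as \<open>t \<le> 1/2 < t'\<close>, the two time
      differences are \<open>1 - 2 * t\<close> and \<open>2 * t' - 1\<close>, with sum
      \<open>2 * (t' - t)\<close>.\<close>
    also have "\<dots> = 2 * L * \<bar>t - t'\<bar>"
      using that x UV by (auto simp: algebra_simps subsetD)
    also have "\<dots> \<le> 2 * L * (d z z' + \<bar>t - t'\<bar>)"
      using L0 by (intro mult_left_mono) auto
    finally show ?thesis .
  qed
  have lip: "d (k (z, t)) (k (z', t')) \<le> 2 * L * (d z z' + \<bar>t - t'\<bar>)"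
    if "z \<in> U" "z' \<in> U" "t \<in> {0..1}" "t' \<in> {0..1}" for z z' t t'
  proof -
    consider "t \<le> 1/2" "t' \<le> 1/2" | "t \<le> 1/2" "\<not> t' \<le> 1/2"
      | "\<not> t \<le> 1/2" "t' \<le> 1/2" | "\<not> t \<le> 1/2" "\<not> t' \<le> 1/2" by blast
    then show ?thesis
    proof cases
      case 1
      then have "d (k (z, t)) (k (z', t')) \<le> L * (d z z' + \<bar>2 * t - 2 * t'\<bar>)"
        using that by (simp add: k_def L)
      also have "\<dots> \<le> L * (2 * (d z z' + \<bar>t - t'\<bar>))"
        using L0 nonneg[of z z'] by (intro mult_left_mono) (simp_all add: abs_if del: nonneg)
      finally show ?thesis by (simp add: algebra_simps)
    next
      case 2
      with that show ?thesis by (intro mixed)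
    next
      case 3
      with that mixed[of z' z t' t] show ?thesis
        by (simp add: commute abs_minus_commute)
    next
      \<comment> \<open>Both points now lie on the track of \<open>x\<close>, so only the difference
        of times contributes.\<close>
      case 4
      have xx: "d x x = 0" using x UV by auto
      have "d (k (z, t)) (k (z', t')) = d (h (x, 2 - 2 * t)) (h (x, 2 - 2 * t'))"
        using 4 by (simp add: k_def)
      also have "\<dots> \<le> L * (d x x + \<bar>(2 - 2 * t) - (2 - 2 * t')\<bar>)"
        using 4 that x by (intro L) auto
      also have "\<dots> \<le> L * (2 * (d z z' + \<bar>t - t'\<bar>))"
        using L0 nonneg[of z z'] xx by (intro mult_left_mono) (simp_all add: abs_if del: nonneg)
      finally show ?thesis by (simp add: algebra_simps)
    qed
  qed
  have "lipschitz_contraction U V x k"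
    unfolding lipschitz_contraction_def
  proof (intro conjI)
    show "x \<in> V" using x UV by blast
    show "\<exists>C. \<forall>z\<in>U. \<forall>z'\<in>U. \<forall>t\<in>{0..1}. \<forall>t'\<in>{0..1}.
        d (k (z, t)) (k (z', t')) \<le> C * (d z z' + \<bar>t - t'\<bar>)"
      using lip by blast
  qed (use UV kV x h0 in \<open>auto simp: k_def\<close>)
  then show ?thesis
    unfolding lipschitz_contractible_to_def by blast
qed

text \<open>An open set contains a ball around each of its points. Contractibility inside that ball
  passes to the larger target \<open>U\<close>, with the centre as end point.\<close>

lemma locally_lipschitz_contractible_imp_weakly:
  assumes "locally_lipschitz_contractible"
  shows "weakly_locally_lipschitz_contractible"
  unfolding weakly_locally_lipschitz_contractible_def
proof (intro ballI allI impI)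
  fix x U
  assume x: "x \<in> M" and U: "openin mtopology U \<and> x \<in> U"
  then obtain r where r: "r > 0" "mball x r \<subseteq> U" and UM: "U \<subseteq> M"
    unfolding openin_mtopology by blast
  then obtain r' where r': "0 < r'" "r' \<le> r"
    and c: "lipschitz_contractible_to (mball x r') (mball x r) x"
    using assms x unfolding locally_lipschitz_contractible_def by fastforce
  have "lipschitz_contractible_to (mball x r') U x"
    using c r(2) UM by (rule lipschitz_contractible_to_mono)
  moreover have "mball x r' \<subseteq> U"
    using mball_subset_concentric[OF r'(2)] r by blast
  ultimately show "\<exists>V. openin mtopology V \<and> x \<in> V \<and> V \<subseteq> U \<and>
      (\<exists>y\<in>U. lipschitz_contractible_to V U y)"
    using x r' U by (intro exI[of _ "mball x r'"]) auto
qed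

lemma locally_strong_imp_locally_lipschitz_contractible:
  assumes "admits_locally_strong_lipschitz_contractions"
  shows "locally_lipschitz_contractible"
  unfolding locally_lipschitz_contractible_def
proof (intro ballI allI impI)
  fix x and r :: real
  assume x: "x \<in> M" and r: "0 < r"
  obtain r0 \<gamma> where "r0 > 0" and \<gamma>: "\<gamma> > 0"
    and strong: "\<And>S. S \<subseteq> mball x r0 \<Longrightarrow> \<exists>y\<in>M. \<exists>\<phi>. lipschitz_contraction S M y \<phi> \<and>
           (\<forall>z\<in>S. \<forall>z'\<in>S. \<forall>t\<in>{0..1}. \<forall>t'\<in>{0..1}.
              d (\<phi> (z, t)) (\<phi> (z', t')) \<le> \<gamma> * mdiameter S * \<bar>t - t'\<bar> + \<gamma> * d z z')"
    using assms x unfolding admits_locally_strong_lipschitz_contractions_def by metis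
  \<comment> \<open>The bound \<open>r0\<close> makes the hypothesis applicable to the ball. The
    other bound leaves room for a starting point within \<open>r'\<close> of \<open>x\<close>
    followed by a displacement of at most \<open>2 * \<gamma> * r'\<close>.\<close>
  define r' where "r' = min r0 (r / (1 + 2 * \<gamma>))"
  have r'0: "0 < r'" "r' \<le> r0"
    using \<open>r0 > 0\<close> r \<gamma> by (auto simp: r'_def)
  have "r' \<le> r / (1 + 2 * \<gamma>)" by (simp add: r'_def)
  then have r'r: "r' + 2 * \<gamma> * r' \<le> r"
    using \<gamma> by (simp add: pos_le_divide_eq algebra_simps)
  have "r' \<le> r"
    using r'r r'0 \<gamma> by (smt (verit) mult_pos_pos)
  define S where "S = mball x r'"
  have "S \<subseteq> mball x r0"
    unfolding S_def using r'0 by (intro mball_subset_concentric)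
  then obtain y \<phi> where \<phi>: "lipschitz_contraction S M y \<phi>"
    and est: "\<And>z z' t t'. \<lbrakk>z \<in> S; z' \<in> S; t \<in> {0..1}; t' \<in> {0..1}\<rbrakk> \<Longrightarrow>
        d (\<phi> (z, t)) (\<phi> (z', t')) \<le> \<gamma> * mdiameter S * \<bar>t - t'\<bar> + \<gamma> * d z z'"
    using strong[of S] by blast
  have diam: "mdiameter S \<le> 2 * r'"
    unfolding S_def using r'0 by (intro mdiameter_mball_le) auto
  have xS: "x \<in> S" using x r'0 by (simp add: S_def)
  have SM: "S \<subseteq> M" by (auto simp: S_def)
  have \<phi>M: "\<phi> (z, t) \<in> M" if "z \<in> S" "t \<in> {0..1}" for z t
    using \<phi> that unfolding lipschitz_contraction_def by blast
  have \<phi>0: "\<phi> (z, 0) = z" and \<phi>1: "\<phi> (z, 1) = y" if "z \<in> S" for z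
    using \<phi> that unfolding lipschitz_contraction_def by blast+
  have ball: "\<phi> (z, t) \<in> mball x r" if "z \<in> S" "t \<in> {0..1}" for z t
  proof -
    have zM: "z \<in> M" and zx: "d x z < r'" using that by (auto simp: S_def)
    \<comment> \<open>Comparing times 0 and \<open>t\<close> at the same point \<open>z\<close>
      removes the term \<open>\<gamma> * d z z'\<close> and leaves the displacement along one
      track.\<close>
    have "d z (\<phi> (z, t)) \<le> \<gamma> * mdiameter S * t"
      using est[of z z 0 t] that zM by (simp add: \<phi>0)
    also have "\<dots> \<le> \<gamma> * (2 * r') * t"
      using diam \<gamma> that by (intro mult_right_mono mult_left_mono) auto
    also have "\<dots> \<le> \<gamma> * (2 * r') * 1"
      using \<gamma> r'0 that by (intro mult_left_mono) auto
    finally have "d x (\<phi> (z, t)) < r"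
      using triangle[OF x zM \<phi>M[OF that]] zx r'r by (simp add: mult_ac)
    with x \<phi>M[OF that] show ?thesis by simp
  qed
  \<comment> \<open>The map is unchanged and only its target shrinks. The end point \<open>y\<close>
    lies in the ball because it ends the track of \<open>x\<close>.\<close>
  have "lipschitz_contraction S (mball x r) y \<phi>"
    unfolding lipschitz_contraction_def
  proof (intro conjI)
    show "S \<subseteq> mball x r"
      unfolding S_def using \<open>r' \<le> r\<close> by (rule mball_subset_concentric)
    show "y \<in> mball x r" using ball[OF xS, of 1] \<phi>1[OF xS] by simp
    show "\<phi> \<in> S \<times> {0..1} \<rightarrow> mball x r" using ball by blast
  qed (use \<phi> mball_subset_mspace in \<open>unfold lipschitz_contraction_def, blast+\<close>)
  then have "lipschitz_contractible_to S (mball x r) y"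
    unfolding lipschitz_contractible_to_def by blast
  then have "lipschitz_contractible_to S (mball x r) x"
    using xS by (rule lipschitz_contractible_to_member)
  then show "\<exists>r'\<in>{0<..r}. lipschitz_contractible_to (mball x r') (mball x r) x"
    using r'0 \<open>r' \<le> r\<close> unfolding S_def by auto
qed

end

theorem lemma2p7:
  fixes M :: "'a set" and d :: "'a \<Rightarrow> 'a \<Rightarrow> real"
  assumes "Metric_space M d"
    and "Metric_space.admits_locally_strong_lipschitz_contractions M d"
  shows "Metric_space.weakly_locally_lipschitz_contractible M d \<and>
         Metric_space.locally_lipschitz_contractible M d"
proof -
  interpret Metric_space M d by fact
  show ?thesis
    using assms(2) locally_strong_imp_locally_lipschitz_contractible
      locally_lipschitz_contractible_imp_weakly by blast
qed

end
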